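(* Let $G$ be a group, let $X$ be an infinite transitive $G$-space and let $A\subseteq X$. Then $A$ is prethick (i.e. there exists a finite subset $F\subseteq G$ such that $FA$ is thick) if and only if there exists $p\in X^*$ such that $A\in p$ and $(\beta G)p=\{qp: q\in\beta G\}$ is a minimal invariant subset of $\beta X$.
   Context: A $G$-space is a set $X$ with an action $G\times X\to X$, $(g,x)\mapsto gx$; it is transitive if for all $x,y\in X$ there is $g\in G$ with $gx=y$. For $K\subseteq G$ and $A\subseteq X$, $KA=\{ka:k\in K,a\in A\}$. A subset $B\subseteq X$ is thick if for every finite $K\subseteq G$ there is $b\in B$ with $Kb\subseteq B$. $G$ and $X$ carry the discrete topology, and $\beta G$, $\beta X$ are the sets of all ultrafilters on $G$, $X$ (principal ultrafilters identified with points), with the topology whose base consists of the sets $\overline{A}=\{p: A\in p\}$; $X^*=\beta X\setminus X$ is the set of free ultrafilters on $X$. For $g\in G$ and $p\in\beta X$, $gp=\{gP:P\in p\}$ where $gP=\{gx:x\in P\}$. For $q\in\beta G$ and $p\in\beta X$, $qp$ is the ultrafilter on $X$ defined by: $B\in qp$ if and only if $\{g\in G: B\in gp\}\in q$. A closed subset $S\subseteq\beta X$ is invariant if $gp\in S$ whenever $g\in G$, $p\in S$; a minimal invariant subset is a nonempty closed invariant subset minimal with respect to inclusion among such sets. *)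

theory Defs
  imports "HOL-Algebra.Group_Action" "HOL-Analysis.Abstract_Topology"
begin

text \<open>
  A \<open>G\<close>-space is a carrier set \<open>X\<close> with the library's \<open>group_action G X \<phi>\<close>, where \<open>\<phi> g x\<close> is \<open>g x\<close>.
  Ultrafilters on a carrier set \<open>X\<close> are families of subsets of \<open>X\<close>.
\<close>

definition set_act :: "('g \<Rightarrow> 'x \<Rightarrow> 'x) \<Rightarrow> 'g set \<Rightarrow> 'x set \<Rightarrow> 'x set" where
  "set_act \<phi> K A = {\<phi> k a | k a. k \<in> K \<and> a \<in> A}"

definition thick :: "('g, 'm) monoid_scheme \<Rightarrow> 'x set \<Rightarrow> ('g \<Rightarrow> 'x \<Rightarrow> 'x) \<Rightarrow> 'x set \<Rightarrow> bool" where
  "thick G X \<phi> B \<longleftrightarrow>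
     B \<subseteq> X \<and> (\<forall>K. finite K \<and> K \<subseteq> carrier G \<longrightarrow> (\<exists>b\<in>B. set_act \<phi> K {b} \<subseteq> B))"

definition prethick :: "('g, 'm) monoid_scheme \<Rightarrow> 'x set \<Rightarrow> ('g \<Rightarrow> 'x \<Rightarrow> 'x) \<Rightarrow> 'x set \<Rightarrow> bool" where
  "prethick G X \<phi> A \<longleftrightarrow> (\<exists>F. finite F \<and> F \<subseteq> carrier G \<and> thick G X \<phi> (set_act \<phi> F A))"

definition ultrafilter_on :: "'a set \<Rightarrow> 'a set set \<Rightarrow> bool" where
  "ultrafilter_on X p \<longleftrightarrow>
     p \<subseteq> Pow X \<and> X \<in> p \<and> {} \<notin> p \<and>
     (\<forall>A\<in>p. \<forall>B\<in>p. A \<inter> B \<in> p) \<and>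
     (\<forall>A\<in>p. \<forall>B. A \<subseteq> B \<and> B \<subseteq> X \<longrightarrow> B \<in> p) \<and>
     (\<forall>A. A \<subseteq> X \<longrightarrow> A \<in> p \<or> X - A \<in> p)"

definition beta :: "'a set \<Rightarrow> 'a set set set" where
  "beta X = {p. ultrafilter_on X p}"

definition principal_ultrafilter :: "'a set \<Rightarrow> 'a \<Rightarrow> 'a set set" where
  "principal_ultrafilter X x = {A. A \<subseteq> X \<and> x \<in> A}"

definition free_ultrafilters :: "'a set \<Rightarrow> 'a set set set" where
  "free_ultrafilters X = beta X - principal_ultrafilter X ` X"

definition beta_basic :: "'a set \<Rightarrow> 'a set \<Rightarrow> 'a set set set" where
  "beta_basic X A = {p \<in> beta X. A \<in> p}"

definition beta_topology :: "'a set \<Rightarrow> 'a set set topology" where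
  "beta_topology X = topology_generated_by {beta_basic X A | A. A \<subseteq> X}"

definition ultra_act :: "('g \<Rightarrow> 'x \<Rightarrow> 'x) \<Rightarrow> 'g \<Rightarrow> 'x set set \<Rightarrow> 'x set set" where
  "ultra_act \<phi> g p = {\<phi> g ` P | P. P \<in> p}"

definition ultra_prod ::
  "('g, 'm) monoid_scheme \<Rightarrow> 'x set \<Rightarrow> ('g \<Rightarrow> 'x \<Rightarrow> 'x) \<Rightarrow> 'g set set \<Rightarrow> 'x set set \<Rightarrow> 'x set set" where
  "ultra_prod G X \<phi> q p = {B. B \<subseteq> X \<and> {g \<in> carrier G. B \<in> ultra_act \<phi> g p} \<in> q}"

definition closed_invariant ::
  "('g, 'm) monoid_scheme \<Rightarrow> 'x set \<Rightarrow> ('g \<Rightarrow> 'x \<Rightarrow> 'x) \<Rightarrow> 'x set set set \<Rightarrow> bool" where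
  "closed_invariant G X \<phi> S \<longleftrightarrow>
     closedin (beta_topology X) S \<and> (\<forall>g\<in>carrier G. \<forall>p\<in>S. ultra_act \<phi> g p \<in> S)"

definition minimal_invariant ::
  "('g, 'm) monoid_scheme \<Rightarrow> 'x set \<Rightarrow> ('g \<Rightarrow> 'x \<Rightarrow> 'x) \<Rightarrow> 'x set set set \<Rightarrow> bool" where
  "minimal_invariant G X \<phi> S \<longleftrightarrow>
     S \<noteq> {} \<and> closed_invariant G X \<phi> S \<and>
     (\<forall>T. T \<noteq> {} \<and> closed_invariant G X \<phi> T \<and> T \<subseteq> S \<longrightarrow> T = S)"

text \<open>
  \<open>topology_generated_by\<close> takes a subbase; the sets \<open>beta_basic X A\<close> are nevertheless a base of the
  topology, because they are closed under finite intersections and include the whole space.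
\<close>

lemma beta_basic_Int:
  assumes "A \<subseteq> X" "B \<subseteq> X"
  shows "beta_basic X A \<inter> beta_basic X B = beta_basic X (A \<inter> B)"
  using assms unfolding beta_basic_def beta_def ultrafilter_on_def
  by auto

lemma topspace_beta_topology: "topspace (beta_topology X) = beta X"
proof -
  have "beta_basic X X = beta X"
    by (auto simp: beta_basic_def beta_def ultrafilter_on_def)
  then show ?thesis
    unfolding beta_topology_def topology_generated_by_topspace
    by (auto simp: beta_basic_def)
qed

lemma openin_beta_topology_base:
  "openin (beta_topology X) U \<longleftrightarrow>
     U \<subseteq> beta X \<and> (\<forall>p\<in>U. \<exists>A. A \<subseteq> X \<and> p \<in> beta_basic X A \<and> beta_basic X A \<subseteq> U)"
    (is "_ \<longleftrightarrow> ?R U")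
proof
  assume op: "openin (beta_topology X) U"
  then have "generate_topology_on {beta_basic X A | A. A \<subseteq> X} U"
    unfolding beta_topology_def by (rule openin_topology_generated_by)
  then have "\<forall>p\<in>U. \<exists>A. A \<subseteq> X \<and> p \<in> beta_basic X A \<and> beta_basic X A \<subseteq> U"
  proof induction
    case (Int a b)
    show ?case
    proof
      fix p assume p: "p \<in> a \<inter> b"
      obtain A where A: "A \<subseteq> X" "p \<in> beta_basic X A" "beta_basic X A \<subseteq> a"
        using Int.IH(1) p by auto
      obtain B where B: "B \<subseteq> X" "p \<in> beta_basic X B" "beta_basic X B \<subseteq> b"
        using Int.IH(2) p by auto
      have "A \<inter> B \<subseteq> X" using A by auto
      moreover have "p \<in> beta_basic X (A \<inter> B) \<and> beta_basic X (A \<inter> B) \<subseteq> a \<inter> b"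
        unfolding beta_basic_Int[OF A(1) B(1), symmetric] using A B by auto
      ultimately show "\<exists>C. C \<subseteq> X \<and> p \<in> beta_basic X C \<and> beta_basic X C \<subseteq> a \<inter> b"
        by auto
    qed
  next
    case (UN K)
    then show ?case by (meson UnionE Union_upper order_trans)
  qed auto
  moreover have "U \<subseteq> beta X"
    using openin_subset[OF op] by (simp add: topspace_beta_topology)
  ultimately show "?R U" by blast
next
  assume R: "?R U"
  then have "U = \<Union>{beta_basic X A | A. A \<subseteq> X \<and> beta_basic X A \<subseteq> U}" by blast
  moreover have "openin (beta_topology X) (beta_basic X A)" if "A \<subseteq> X" for A
    unfolding beta_topology_def using that by (intro topology_generated_by_Basis) blast
  then have "openin (beta_topology X) (\<Union>{beta_basic X A | A. A \<subseteq> X \<and> beta_basic X A \<subseteq> U})"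
    by (intro openin_Union) blast
  ultimately show "openin (beta_topology X) U" by simp
qed

lemma (in group_action) ultra_act_iff:
  assumes "g \<in> carrier G" "p \<in> beta E" "B \<subseteq> E"
  shows "B \<in> ultra_act \<phi> g p \<longleftrightarrow> {x \<in> E. \<phi> g x \<in> B} \<in> p"
proof -
  have b: "inj_on (\<phi> g) E" "\<phi> g ` E = E"
    using assms inj_prop surj_prop by auto
  have p: "P \<subseteq> E" if "P \<in> p" for P
    using that assms by (auto simp: beta_def ultrafilter_on_def)
  have 1: "\<phi> g ` {x \<in> E. \<phi> g x \<in> B} = B"
  proof (intro equalityI subsetI)
    fix y assume "y \<in> B"
    then obtain x where "x \<in> E" "y = \<phi> g x" using b(2) assms(3) by (metis imageE subsetD)
    with \<open>y \<in> B\<close> show "y \<in> \<phi> g ` {x \<in> E. \<phi> g x \<in> B}" by simp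
  qed auto
  have 2: "{x \<in> E. \<phi> g x \<in> \<phi> g ` P} = P" if "P \<subseteq> E" for P
    using that b(1) by (auto simp: inj_on_def)
  show ?thesis
  proof
    assume "B \<in> ultra_act \<phi> g p"
    then obtain P where P: "P \<in> p" "B = \<phi> g ` P" by (auto simp: ultra_act_def)
    have "{x \<in> E. \<phi> g x \<in> B} = P" unfolding P(2) by (rule 2[OF p[OF P(1)]])
    with P(1) show "{x \<in> E. \<phi> g x \<in> B} \<in> p" by simp
  next
    assume "{x \<in> E. \<phi> g x \<in> B} \<in> p"
    then show "B \<in> ultra_act \<phi> g p" unfolding ultra_act_def using 1[symmetric] by blast
  qed
qed

lemma (in group_action) ultra_act_beta:
  assumes g: "g \<in> carrier G" and p: "p \<in> beta E"
  shows "ultra_act \<phi> g p \<in> beta E"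
proof -
  have sub: "ultra_act \<phi> g p \<subseteq> Pow E"
    using p surj_prop[OF g] by (fastforce simp: ultra_act_def beta_def ultrafilter_on_def)
  note iff = ultra_act_iff[OF g p]
  have u: "ultrafilter_on E p" using p by (simp add: beta_def)
  have "E \<in> ultra_act \<phi> g p"
  proof -
    have "{x \<in> E. \<phi> g x \<in> E} = E" using surj_prop[OF g] by auto
    then show ?thesis using iff[of E] u by (simp add: ultrafilter_on_def)
  qed
  moreover have "{} \<notin> ultra_act \<phi> g p"
    using iff[of "{}"] u by (simp add: ultrafilter_on_def)
  moreover have "A \<inter> B \<in> ultra_act \<phi> g p"
    if "A \<in> ultra_act \<phi> g p" "B \<in> ultra_act \<phi> g p" for A B
  proof -
    have s: "A \<subseteq> E" "B \<subseteq> E" using that sub by auto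
    have "{x \<in> E. \<phi> g x \<in> A} \<inter> {x \<in> E. \<phi> g x \<in> B} \<in> p"
      using that s iff u by (simp add: ultrafilter_on_def)
    moreover have "{x \<in> E. \<phi> g x \<in> A} \<inter> {x \<in> E. \<phi> g x \<in> B} = {x \<in> E. \<phi> g x \<in> A \<inter> B}" by auto
    ultimately show ?thesis using iff[of "A \<inter> B"] s by auto
  qed
  moreover have "B \<in> ultra_act \<phi> g p"
    if "A \<in> ultra_act \<phi> g p" "A \<subseteq> B" "B \<subseteq> E" for A B
  proof -
    have "{x \<in> E. \<phi> g x \<in> A} \<in> p" using that iff by auto
    moreover have "{x \<in> E. \<phi> g x \<in> A} \<subseteq> {x \<in> E. \<phi> g x \<in> B}" using that by auto
    ultimately have "{x \<in> E. \<phi> g x \<in> B} \<in> p"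
      using u unfolding ultrafilter_on_def by (metis (no_types, lifting) mem_Collect_eq subsetI)
    then show ?thesis using iff that by auto
  qed
  moreover have "A \<in> ultra_act \<phi> g p \<or> E - A \<in> ultra_act \<phi> g p" if "A \<subseteq> E" for A
  proof -
    have "E - {x \<in> E. \<phi> g x \<in> A} = {x \<in> E. \<phi> g x \<in> E - A}" using surj_prop[OF g] by auto
    moreover have "{x \<in> E. \<phi> g x \<in> A} \<in> p \<or> E - {x \<in> E. \<phi> g x \<in> A} \<in> p"
      using u unfolding ultrafilter_on_def by auto
    ultimately show ?thesis using iff[of A] iff[of "E - A"] that by auto
  qed
  ultimately show ?thesis using sub unfolding beta_def ultrafilter_on_def by blast
qed

lemma (in group_action) ultra_prod_beta:
  assumes q: "q \<in> beta (carrier G)" and p: "p \<in> beta E"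
  shows "ultra_prod G E \<phi> q p \<in> beta E"
proof -
  let ?S = "\<lambda>B. {g \<in> carrier G. B \<in> ultra_act \<phi> g p}"
  have uq: "ultrafilter_on (carrier G) q" using q by (simp add: beta_def)
  have ug: "ultrafilter_on E (ultra_act \<phi> g p)" if "g \<in> carrier G" for g
    using ultra_act_beta[OF that p] by (simp add: beta_def)
  have up: "T \<in> q" if "S \<in> q" "S \<subseteq> T" "T \<subseteq> carrier G" for S T
    using uq that unfolding ultrafilter_on_def by blast
  have "?S E = carrier G" using ug by (auto simp: ultrafilter_on_def)
  then have "?S E \<in> q" using uq by (simp add: ultrafilter_on_def)
  moreover have "?S {} = {}" using ug by (auto simp: ultrafilter_on_def)
  then have "?S {} \<notin> q" using uq unfolding ultrafilter_on_def by metis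
  moreover have "?S (A \<inter> B) \<in> q" if "?S A \<in> q" "?S B \<in> q" for A B
  proof -
    have "?S A \<inter> ?S B \<in> q" using uq that by (simp add: ultrafilter_on_def)
    moreover have "?S A \<inter> ?S B \<subseteq> ?S (A \<inter> B)"
      using ug unfolding ultrafilter_on_def by blast
    ultimately show ?thesis by (rule up) auto
  qed
  moreover have "?S B \<in> q" if "?S A \<in> q" "A \<subseteq> B" "B \<subseteq> E" for A B
  proof -
    have "?S A \<subseteq> ?S B" using ug that(2,3) unfolding ultrafilter_on_def by blast
    with that(1) show ?thesis by (rule up) auto
  qed
  moreover have "?S A \<in> q \<or> ?S (E - A) \<in> q" if "A \<subseteq> E" for A
  proof -
    have "?S A \<in> q \<or> carrier G - ?S A \<in> q" using uq by (simp add: ultrafilter_on_def)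
    moreover have "carrier G - ?S A \<subseteq> ?S (E - A)"
      using ug that unfolding ultrafilter_on_def by blast
    ultimately show ?thesis using up[of "carrier G - ?S A" "?S (E - A)"] by auto
  qed
  ultimately have "ultrafilter_on E {B. B \<subseteq> E \<and> ?S B \<in> q}"
    unfolding ultrafilter_on_def mem_Collect_eq by blast
  then show ?thesis by (simp add: beta_def ultra_prod_def)
qed

end

theory Submission
  imports Defs
begin

text \<open>
  The set \<open>(\<beta>G)p\<close> is the closure of the orbit \<open>Gp\<close>, hence the least closed invariant set
  containing \<open>p\<close>. If \<open>FA\<close> is thick, some ultrafilter \<open>r\<close> has \<open>FA \<in> gr\<close> for all \<open>g\<close>. By
  compactness \<open>(\<beta>G)r\<close> contains a minimal invariant set \<open>M\<close>; every \<open>s \<in> M\<close> contains \<open>FA\<close>, hence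
  \<open>fA\<close> for some \<open>f \<in> F\<close>, and \<open>p = f\<^sup>-\<^sup>1s\<close> is as required. It is free, because the free ultrafilters
  form a nonempty closed invariant set, whereas by transitivity the closed invariant set generated
  by a principal ultrafilter contains all principal ones. Conversely, if \<open>(\<beta>G)p\<close> is minimal then
  every \<open>r \<in> (\<beta>G)p\<close> has \<open>p\<close> in its orbit closure, so \<open>r\<close> contains a translate of \<open>A\<close>. Compactness
  yields a finite \<open>F\<close> with \<open>FA \<in> hp\<close> for all \<open>h\<close>, and so \<open>FA\<close> is thick.
\<close>

section \<open>Ultrafilters on a carrier set\<close>

lemma betaD:
  assumes "p \<in> beta X"
  shows beta_subset: "B \<in> p \<Longrightarrow> B \<subseteq> X"
    and beta_carrier: "X \<in> p"
    and beta_empty: "{} \<notin> p"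
    and beta_Int: "A \<in> p \<Longrightarrow> B \<in> p \<Longrightarrow> A \<inter> B \<in> p"
    and beta_mono: "A \<in> p \<Longrightarrow> A \<subseteq> B \<Longrightarrow> B \<subseteq> X \<Longrightarrow> B \<in> p"
    and beta_cases: "A \<subseteq> X \<Longrightarrow> A \<in> p \<or> X - A \<in> p"
  using assms unfolding beta_def ultrafilter_on_def mem_Collect_eq by blast+

lemma beta_Diff_iff:
  assumes "p \<in> beta X" "A \<subseteq> X"
  shows "X - A \<in> p \<longleftrightarrow> A \<notin> p"
proof -
  have "A \<inter> (X - A) = {}" by auto
  then show ?thesis
    using beta_cases[OF assms] beta_Int[OF assms(1), of A "X - A"] beta_empty[OF assms(1)] by auto
qed

text \<open>Ultrafilters are maximal: if \<open>B\<close> in \<open>q\<close> were missing from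
  \<open>p\<close>, its complement would lie in \<open>p\<close> and hence in
  \<open>q\<close>.\<close>

lemma beta_eqI:
  assumes "p \<in> beta X" "q \<in> beta X" "p \<subseteq> q"
  shows "p = q"
proof
  show "q \<subseteq> p"
  proof
    fix B assume B: "B \<in> q"
    then have "B \<subseteq> X" by (rule beta_subset[OF assms(2)])
    with B show "B \<in> p" using beta_Diff_iff assms by blast
  qed
qed (rule assms(3))

text \<open>Induction on \<open>I\<close>: a piece outside \<open>p\<close> is removed by
  intersecting the union with its complement. This later selects a single translate of
  \<open>A\<close> out of \<open>set_act \<phi> F A\<close>.\<close>

lemma beta_UN:
  assumes "p \<in> beta X" "finite I" "\<And>i. i \<in> I \<Longrightarrow> A i \<subseteq> X" "(\<Union>i\<in>I. A i) \<in> p"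
  shows "\<exists>i\<in>I. A i \<in> p"
  using assms(2-4)
proof (induction I rule: finite_induct)
  case empty
  then show ?case using beta_empty[OF assms(1)] by simp
next
  case (insert i I)
  show ?case
  proof (cases "A i \<in> p")
    case False
    have sub: "A i \<subseteq> X" "(\<Union>i\<in>I. A i) \<subseteq> X" using insert.prems(1) by auto
    with False have "X - A i \<in> p" using beta_Diff_iff[OF assms(1)] by simp
    then have "(X - A i) \<inter> (\<Union>i\<in>insert i I. A i) \<in> p"
      using insert.prems(2) by (rule beta_Int[OF assms(1)])
    then have "(\<Union>i\<in>I. A i) \<in> p"
      by (rule beta_mono[OF assms(1)]) (use sub in auto)
    then show ?thesis using insert.IH insert.prems(1) by auto
  qed auto
qed

text \<open>The intersection is written as a comprehension over \<open>X\<close>, so that an empty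
  index set yields \<open>X\<close> instead of the whole type.\<close>

lemma beta_finite_Inter:
  assumes "p \<in> beta X" "finite I" "\<And>i. i \<in> I \<Longrightarrow> A i \<in> p"
  shows "{x \<in> X. \<forall>i\<in>I. x \<in> A i} \<in> p"
  using assms(2,3)
proof (induction I rule: finite_induct)
  case empty
  then show ?case using beta_carrier[OF assms(1)] by simp
next
  case (insert i I)
  have "A i \<inter> {x \<in> X. \<forall>i\<in>I. x \<in> A i} \<in> p"
    using insert by (intro beta_Int[OF assms(1)]) auto
  then show ?case by (rule beta_mono[OF assms(1)]) auto
qed

text \<open>Zorn's lemma gives a maximal proper filter above \<open>\<B>\<close>, and maximality
  forces the dichotomy between a set and its complement. The hypothesis is directedness because
  every family to which the lemma is applied below is directed downwards.\<close>

lemma ultrafilter_extension: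
  assumes sub: "\<B> \<subseteq> Pow X" and ne: "\<B> \<noteq> {}" and emp: "{} \<notin> \<B>"
    and dir: "\<And>A B. A \<in> \<B> \<Longrightarrow> B \<in> \<B> \<Longrightarrow> \<exists>C\<in>\<B>. C \<subseteq> A \<inter> B"
  obtains p where "p \<in> beta X" "\<B> \<subseteq> p"
proof -
  define filt where "filt D \<longleftrightarrow> \<B> \<subseteq> D \<and> D \<subseteq> Pow X \<and> {} \<notin> D \<and> (\<forall>A\<in>D. \<forall>B\<in>D. A \<inter> B \<in> D) \<and>
    (\<forall>A\<in>D. \<forall>B. A \<subseteq> B \<and> B \<subseteq> X \<longrightarrow> B \<in> D)" for D
  have filtI: "filt D" if "\<B> \<subseteq> D" "D \<subseteq> Pow X" "{} \<notin> D"
    "\<And>A B. A \<in> D \<Longrightarrow> B \<in> D \<Longrightarrow> A \<inter> B \<in> D"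
    "\<And>A B. A \<in> D \<Longrightarrow> A \<subseteq> B \<Longrightarrow> B \<subseteq> X \<Longrightarrow> B \<in> D" for D
    unfolding filt_def
  proof (intro conjI ballI allI impI)
    show "B \<in> D" if "A \<in> D" "A \<subseteq> B \<and> B \<subseteq> X" for A B
      using \<open>\<And>A B. A \<in> D \<Longrightarrow> A \<subseteq> B \<Longrightarrow> B \<subseteq> X \<Longrightarrow> B \<in> D\<close>[of A B] that by simp
  qed (simp_all add: that)
  have filtD: "\<B> \<subseteq> D" "D \<subseteq> Pow X" "{} \<notin> D"
    "A \<in> D \<Longrightarrow> B \<in> D \<Longrightarrow> A \<inter> B \<in> D"
    "A \<in> D \<Longrightarrow> A \<subseteq> B \<Longrightarrow> B \<subseteq> X \<Longrightarrow> B \<in> D" if "filt D" for D A B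
    using that unfolding filt_def by blast+
  have "filt {C. C \<subseteq> X \<and> (\<exists>B\<in>\<B>. B \<subseteq> C)}" (is "filt ?U")
  proof (rule filtI)
    fix A B assume U: "A \<in> ?U" "B \<in> ?U"
    obtain A' B' where AB: "A' \<in> \<B>" "B' \<in> \<B>" "A' \<subseteq> A" "B' \<subseteq> B" using U by blast
    obtain C where "C \<in> \<B>" "C \<subseteq> A' \<inter> B'" using dir[OF AB(1,2)] by blast
    with AB U show "A \<inter> B \<in> ?U" by blast
  next
    fix A B assume "A \<in> ?U" "A \<subseteq> B" "B \<subseteq> X"
    then show "B \<in> ?U" by blast
  qed (use sub emp in auto)
  then have "Collect filt \<noteq> {}" by blast
  then have "\<exists>M\<in>Collect filt. \<forall>D\<in>Collect filt. M \<subseteq> D \<longrightarrow> D = M"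
  proof (rule subset_Zorn_nonempty)
    fix \<C> assume ne': "\<C> \<noteq> {}" and ch: "subset.chain (Collect filt) \<C>"
    have \<C>: "filt D" if "D \<in> \<C>" for D using ch that by (auto simp: subset_chain_def)
    have "filt (\<Union>\<C>)"
    proof (rule filtI)
      fix A B assume AB: "A \<in> \<Union>\<C>" "B \<in> \<Union>\<C>"
      obtain D E where DE: "D \<in> \<C>" "E \<in> \<C>" "A \<in> D" "B \<in> E" using AB by blast
      have "D \<subseteq> E \<or> E \<subseteq> D" using ch DE by (auto simp: subset_chain_def)
      then obtain H where H: "H \<in> \<C>" "A \<in> H" "B \<in> H" using DE by blast
      then have "A \<inter> B \<in> H" using filtD(4)[OF \<C>] by simp
      with H show "A \<inter> B \<in> \<Union>\<C>" by blast
    next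
      fix A B assume "A \<in> \<Union>\<C>" and B: "A \<subseteq> B" "B \<subseteq> X"
      then obtain D where D: "D \<in> \<C>" "A \<in> D" by blast
      then have "B \<in> D" using filtD(5)[OF \<C> _ B] by simp
      with D show "B \<in> \<Union>\<C>" by blast
    next
      obtain D where "D \<in> \<C>" using ne' by blast
      then show "\<B> \<subseteq> \<Union>\<C>" using filtD(1)[OF \<C>] by blast
      show "\<Union>\<C> \<subseteq> Pow X" using filtD(2)[OF \<C>] by (rule Union_least)
      show "{} \<notin> \<Union>\<C>" using filtD(3)[OF \<C>] by auto
    qed
    then show "\<Union>\<C> \<in> Collect filt" by simp
  qed
  then obtain M where M: "filt M" and max: "\<And>D. filt D \<Longrightarrow> M \<subseteq> D \<Longrightarrow> D = M" by auto
  note MX = filtD(2)[OF M] and BM = filtD(1)[OF M] and Me = filtD(3)[OF M]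
    and int = filtD(4)[OF M] and up = filtD(5)[OF M]
  obtain B0 where "B0 \<in> M" using ne BM by blast
  then have XM: "X \<in> M" using MX by (intro up[of B0 X]) auto
  have compl: "X - A \<in> M" if A: "A \<subseteq> X" "A \<notin> M" for A
  proof (rule ccontr)
    assume nA: "X - A \<notin> M"
    \<comment> \<open>This is the filter generated by \<open>M\<close> and \<open>A\<close>. It is
      proper, since a member of \<open>M\<close> disjoint from \<open>A\<close> would put
      \<open>X - A\<close> into \<open>M\<close>. As it contains \<open>A\<close>, it contradicts
      the maximality of \<open>M\<close>.\<close>
    let ?D = "{C. C \<subseteq> X \<and> (\<exists>B\<in>M. B \<inter> A \<subseteq> C)}"
    have MD: "M \<subseteq> ?D" using MX by blast
    have "filt ?D"
    proof (rule filtI)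
      show "\<B> \<subseteq> ?D" using BM MD by (rule subset_trans)
      show "{} \<notin> ?D"
      proof
        assume "{} \<in> ?D"
        then obtain B where B: "B \<in> M" "B \<inter> A = {}" by blast
        then have "B \<subseteq> X - A" using MX by blast
        with B nA show False using up[of B "X - A"] by blast
      qed
      fix C C' assume C: "C \<in> ?D" "C' \<in> ?D"
      obtain B B' where "B \<in> M" "B' \<in> M" "B \<inter> A \<subseteq> C" "B' \<inter> A \<subseteq> C'" using C by blast
      then have "B \<inter> B' \<in> M" "(B \<inter> B') \<inter> A \<subseteq> C \<inter> C'" using int by auto
      then show "C \<inter> C' \<in> ?D" using C by blast
    next
      fix C C' assume "C \<in> ?D" "C \<subseteq> C'" "C' \<subseteq> X"
      then show "C' \<in> ?D" by blast
    qed auto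
    then have "?D = M" using MD by (rule max)
    moreover have "A \<in> ?D" using A XM by auto
    ultimately show False using A by simp
  qed
  have "ultrafilter_on X M"
    unfolding ultrafilter_on_def
  proof (intro conjI ballI allI impI)
    show "A \<in> M \<or> X - A \<in> M" if "A \<subseteq> X" for A using compl[OF that] by blast
    show "B \<in> M" if "A \<in> M" "A \<subseteq> B \<and> B \<subseteq> X" for A B using up that by blast
  qed (use MX XM Me int in auto)
  then show ?thesis using BM that by (simp add: beta_def)
qed

section \<open>Closed sets and compactness of the space of ultrafilters\<close>

text \<open>Basic sets are clopen, the complement of the one for \<open>A\<close> being the one for
  \<open>X - A\<close>. A closed set is therefore the intersection of the basic sets that contain
  it.\<close>

lemma beta_closure_iff:
  assumes "closedin (beta_topology X) T" "r \<in> beta X"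
  shows "r \<in> T \<longleftrightarrow> (\<forall>B. B \<subseteq> X \<and> T \<subseteq> beta_basic X B \<longrightarrow> B \<in> r)"
proof
  assume R: "\<forall>B. B \<subseteq> X \<and> T \<subseteq> beta_basic X B \<longrightarrow> B \<in> r"
  show "r \<in> T"
  proof (rule ccontr)
    assume "r \<notin> T"
    moreover have "openin (beta_topology X) (beta X - T)"
      using assms(1) by (simp add: closedin_def topspace_beta_topology)
    ultimately obtain A where A: "A \<subseteq> X" "r \<in> beta_basic X A" "beta_basic X A \<subseteq> beta X - T"
      using assms(2) unfolding openin_beta_topology_base by blast
    have "T \<subseteq> beta X" using closedin_subset[OF assms(1)] by (simp add: topspace_beta_topology)
    then have "T \<subseteq> beta_basic X (X - A)"
      using A beta_Diff_iff unfolding beta_basic_def by blast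
    then have "X - A \<in> r" using R by blast
    then show False using A beta_Diff_iff[OF assms(2) A(1)] by (simp add: beta_basic_def)
  qed
qed (auto simp: beta_basic_def)

lemma closedin_betaI:
  assumes "T \<subseteq> beta X"
    and "\<And>r. r \<in> beta X \<Longrightarrow> r \<notin> T \<Longrightarrow> \<exists>B\<in>r. \<forall>s\<in>T. B \<notin> s"
  shows "closedin (beta_topology X) T"
proof -
  have "\<exists>A. A \<subseteq> X \<and> r \<in> beta_basic X A \<and> beta_basic X A \<subseteq> beta X - T"
    if r: "r \<in> beta X - T" for r
  proof -
    obtain B where B: "B \<in> r" "\<forall>s\<in>T. B \<notin> s" using assms(2) r by blast
    then have "B \<subseteq> X" using beta_subset r by blast
    with B r show ?thesis unfolding beta_basic_def by blast
  qed
  then show ?thesis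
    unfolding closedin_def openin_beta_topology_base topspace_beta_topology using assms(1) by blast
qed

text \<open>Compactness in the form that Zorn's lemma will require. The sets whose basic set covers
  some member of the chain form a filter base; an ultrafilter extending it lies in every member by
  \<open>beta_closure_iff\<close>.\<close>

lemma beta_chain_Inter_nonempty:
  assumes ne: "\<C> \<noteq> {}" and cl: "\<And>T. T \<in> \<C> \<Longrightarrow> T \<noteq> {} \<and> closedin (beta_topology X) T"
    and ch: "\<And>S T. S \<in> \<C> \<Longrightarrow> T \<in> \<C> \<Longrightarrow> S \<subseteq> T \<or> T \<subseteq> S"
  shows "\<Inter>\<C> \<noteq> {}"
proof -
  let ?B = "{B. B \<subseteq> X \<and> (\<exists>T\<in>\<C>. T \<subseteq> beta_basic X B)}"
  have sub: "T \<subseteq> beta X" if "T \<in> \<C>" for T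
    using closedin_subset[of "beta_topology X" T] cl[OF that] by (simp add: topspace_beta_topology)
  obtain r where r: "r \<in> beta X" "?B \<subseteq> r"
  proof (rule ultrafilter_extension[of ?B X])
    have "beta_basic X X = beta X" by (auto simp: beta_basic_def beta_carrier)
    then have "X \<in> ?B" using ne sub by blast
    then show "?B \<noteq> {}" by blast
    have "beta_basic X {} = {}" by (auto simp: beta_basic_def beta_empty)
    then show "{} \<notin> ?B" using cl by auto
    fix A B assume AB: "A \<in> ?B" "B \<in> ?B"
    then obtain S T where ST: "S \<in> \<C>" "T \<in> \<C>" "S \<subseteq> beta_basic X A" "T \<subseteq> beta_basic X B" by blast
    then obtain U where "U \<in> \<C>" "U \<subseteq> beta_basic X A" "U \<subseteq> beta_basic X B"
      using ch[OF ST(1,2)] by (meson subset_trans)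
    then have "A \<inter> B \<in> ?B" using AB beta_basic_Int[of A X B] by blast
    then show "\<exists>C\<in>?B. C \<subseteq> A \<inter> B" by blast
  qed auto
  have "r \<in> T" if T: "T \<in> \<C>" for T
  proof -
    have "B \<in> r" if "B \<subseteq> X" "T \<subseteq> beta_basic X B" for B using r(2) T that by blast
    then show ?thesis using beta_closure_iff[of X T r] cl[OF T] r(1) by simp
  qed
  then show ?thesis by blast
qed

section \<open>Principal and free ultrafilters\<close>

lemma principal_ultrafilter_iff:
  assumes "p \<in> beta X" "x \<in> X"
  shows "p = principal_ultrafilter X x \<longleftrightarrow> {x} \<in> p"
proof
  assume x: "{x} \<in> p"
  have "B \<in> p \<longleftrightarrow> x \<in> B" if "B \<subseteq> X" for B
  proof
    assume "B \<in> p"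
    then have "{x} \<inter> B \<in> p" by (rule beta_Int[OF assms(1) x])
    then have "{x} \<inter> B \<noteq> {}" using beta_empty[OF assms(1)] by metis
    then show "x \<in> B" by simp
  next
    assume "x \<in> B"
    then show "B \<in> p" using that by (intro beta_mono[OF assms(1) x]) auto
  qed
  then show "p = principal_ultrafilter X x"
    unfolding principal_ultrafilter_def using beta_subset[OF assms(1)] by blast
qed (use assms in \<open>auto simp: principal_ultrafilter_def\<close>)

lemma free_ultrafilters_iff:
  "p \<in> free_ultrafilters X \<longleftrightarrow> p \<in> beta X \<and> (\<forall>x\<in>X. {x} \<notin> p)"
  using principal_ultrafilter_iff[of p X] by (auto simp: free_ultrafilters_def)

lemma free_ultrafilters_nonempty:
  assumes "infinite X"
  shows "free_ultrafilters X \<noteq> {}"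
proof -
  \<comment> \<open>The cofinite sets; the empty set is not among them because \<open>X\<close> is
    infinite, and an ultrafilter containing them all contains no singleton.\<close>
  let ?B = "{X - F | F. finite F}"
  obtain p where p: "p \<in> beta X" "?B \<subseteq> p"
  proof (rule ultrafilter_extension[of ?B X])
    show "{} \<notin> ?B" using assms by (auto dest: finite_subset)
    fix A B assume "A \<in> ?B" "B \<in> ?B"
    then obtain F H where "finite F" "finite H" "A = X - F" "B = X - H" by blast
    then have "X - (F \<union> H) \<in> ?B" "X - (F \<union> H) \<subseteq> A \<inter> B" by blast+
    then show "\<exists>C\<in>?B. C \<subseteq> A \<inter> B" by blast
  qed auto
  have "{x} \<notin> p" if "x \<in> X" for x
  proof -
    have "X - {x} \<in> p" using p(2) by blast
    then show ?thesis using beta_Diff_iff[OF p(1)] that by blast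
  qed
  then show ?thesis using p(1) free_ultrafilters_iff by blast
qed

lemma closedin_free_ultrafilters: "closedin (beta_topology X) (free_ultrafilters X)"
proof (rule closedin_betaI)
  fix r assume "r \<in> beta X" "r \<notin> free_ultrafilters X"
  then obtain x where "x \<in> X" "{x} \<in> r" by (auto simp: free_ultrafilters_iff)
  then show "\<exists>B\<in>r. \<forall>s\<in>free_ultrafilters X. B \<notin> s"
    by (intro bexI[of _ "{x}"]) (auto simp: free_ultrafilters_iff)
qed (auto simp: free_ultrafilters_iff)

section \<open>Orbit closures\<close>

context group_action
begin

interpretation group G
  using group_hom by (simp add: group_hom_def)

lemma ultra_act_one:
  assumes "p \<in> beta E"
  shows "ultra_act \<phi> \<one>\<^bsub>G\<^esub> p = p"
proof -
  have "\<phi> \<one>\<^bsub>G\<^esub> ` P = P" if "P \<in> p" for P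
    using beta_subset[OF assms that] unfolding id_eq_one[symmetric] by auto
  then have "{\<phi> \<one>\<^bsub>G\<^esub> ` P | P. P \<in> p} = {P. P \<in> p}" by metis
  then show ?thesis by (simp add: ultra_act_def)
qed

lemma ultra_act_mult:
  assumes "p \<in> beta E" "g \<in> carrier G" "h \<in> carrier G"
  shows "ultra_act \<phi> g (ultra_act \<phi> h p) = ultra_act \<phi> (g \<otimes>\<^bsub>G\<^esub> h) p"
proof -
  have eq: "\<phi> g ` \<phi> h ` P = \<phi> (g \<otimes>\<^bsub>G\<^esub> h) ` P" if "P \<in> p" for P
    unfolding image_image
    using beta_subset[OF assms(1) that] assms(2,3) by (intro image_cong) (auto simp: composition_rule)
  have "ultra_act \<phi> g (ultra_act \<phi> h p) = (\<lambda>P. \<phi> g ` \<phi> h ` P) ` p"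
    unfolding ultra_act_def by blast
  also have "\<dots> = (\<lambda>P. \<phi> (g \<otimes>\<^bsub>G\<^esub> h) ` P) ` p" using eq by (rule image_cong[OF refl])
  also have "\<dots> = ultra_act \<phi> (g \<otimes>\<^bsub>G\<^esub> h) p" unfolding ultra_act_def by blast
  finally show ?thesis .
qed

lemma set_act_subset:
  assumes "F \<subseteq> carrier G" "A \<subseteq> E"
  shows "set_act \<phi> F A \<subseteq> E"
  using assms element_image unfolding set_act_def by blast

text \<open>Exchanges a translate of \<open>A\<close> in an ultrafilter for \<open>A\<close> itself
  in a translated ultrafilter; both directions of the theorem pass through this.\<close>

lemma ultra_act_preimage:
  assumes "g \<in> carrier G" "p \<in> beta E" "A \<subseteq> E"
  shows "\<phi> g ` A \<in> p \<longleftrightarrow> A \<in> ultra_act \<phi> (inv\<^bsub>G\<^esub> g) p"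
proof -
  have "{x \<in> E. \<phi> (inv\<^bsub>G\<^esub> g) x \<in> A} = \<phi> g ` A"
  proof (intro equalityI subsetI)
    fix x assume x: "x \<in> {x \<in> E. \<phi> (inv\<^bsub>G\<^esub> g) x \<in> A}"
    then have "\<phi> g (\<phi> (inv\<^bsub>G\<^esub> g) x) = x"
      using orbit_sym_aux[of "inv\<^bsub>G\<^esub> g" x] assms(1) by simp
    with x show "x \<in> \<phi> g ` A" by force
  next
    fix x assume "x \<in> \<phi> g ` A"
    then obtain a where "a \<in> A" "x = \<phi> g a" by blast
    then show "x \<in> {x \<in> E. \<phi> (inv\<^bsub>G\<^esub> g) x \<in> A}"
      using assms orbit_sym_aux[of g a x] element_image[of g a x] by auto
  qed
  then show ?thesis using ultra_act_iff[of "inv\<^bsub>G\<^esub> g" p A] assms by simp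
qed

text \<open>This is literally the set (\<beta>G)p of the theorem, so the final statement can be
  folded into it. The next lemma justifies the name.\<close>

definition orbit_closure :: "'c set set \<Rightarrow> 'c set set set" where
  "orbit_closure p = {ultra_prod G E \<phi> q p | q. q \<in> beta (carrier G)}"

text \<open>The right-hand side says that every basic neighbourhood of \<open>r\<close> meets the
  orbit of \<open>p\<close>. For such an \<open>r\<close>, the sets of group elements moving
  \<open>p\<close> into these neighbourhoods form a filter base on \<open>carrier G\<close>; any
  ultrafilter \<open>q\<close> extending it satisfies
  \<open>r \<subseteq> ultra_prod G E \<phi> q p\<close>, and inclusion of ultrafilters is
  equality.\<close>

lemma orbit_closure_eq:
  assumes p: "p \<in> beta E"
  shows "orbit_closure p = {r \<in> beta E. \<forall>B\<in>r. \<exists>g\<in>carrier G. B \<in> ultra_act \<phi> g p}"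
proof (intro equalityI subsetI)
  fix r assume "r \<in> orbit_closure p"
  then obtain q where q: "q \<in> beta (carrier G)" "r = ultra_prod G E \<phi> q p"
    by (auto simp: orbit_closure_def)
  have "\<exists>g\<in>carrier G. B \<in> ultra_act \<phi> g p" if "B \<in> r" for B
  proof -
    have "{g \<in> carrier G. B \<in> ultra_act \<phi> g p} \<in> q" using that q(2) by (simp add: ultra_prod_def)
    then have "{g \<in> carrier G. B \<in> ultra_act \<phi> g p} \<noteq> {}" using beta_empty[OF q(1)] by metis
    then show ?thesis by blast
  qed
  then show "r \<in> {r \<in> beta E. \<forall>B\<in>r. \<exists>g\<in>carrier G. B \<in> ultra_act \<phi> g p}"
    using ultra_prod_beta[OF q(1) p] q(2) by blast
next
  fix r assume "r \<in> {r \<in> beta E. \<forall>B\<in>r. \<exists>g\<in>carrier G. B \<in> ultra_act \<phi> g p}"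
  then have r: "r \<in> beta E" and ex: "\<And>B. B \<in> r \<Longrightarrow> \<exists>g\<in>carrier G. B \<in> ultra_act \<phi> g p" by auto
  let ?S = "\<lambda>B. {g \<in> carrier G. B \<in> ultra_act \<phi> g p}"
  obtain q where q: "q \<in> beta (carrier G)" "?S ` r \<subseteq> q"
  proof (rule ultrafilter_extension[of "?S ` r" "carrier G"])
    show "?S ` r \<noteq> {}" using beta_carrier[OF r] by blast
    show "{} \<notin> ?S ` r" using ex by blast
    fix U V assume "U \<in> ?S ` r" "V \<in> ?S ` r"
    then obtain A B where AB: "A \<in> r" "B \<in> r" "U = ?S A" "V = ?S B" by blast
    have "?S (A \<inter> B) \<subseteq> ?S A \<inter> ?S B"
      using beta_mono[OF ultra_act_beta[OF _ p]] beta_subset[OF r] AB(1,2) by blast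
    then show "\<exists>C\<in>?S ` r. C \<subseteq> U \<inter> V" using AB beta_Int[OF r AB(1,2)] by blast
  qed auto
  have "r \<subseteq> ultra_prod G E \<phi> q p"
    using q(2) beta_subset[OF r] unfolding ultra_prod_def by blast
  then have "r = ultra_prod G E \<phi> q p" by (rule beta_eqI[OF r ultra_prod_beta[OF q(1) p]])
  then show "r \<in> orbit_closure p" using q(1) by (auto simp: orbit_closure_def)
qed

lemma orbit_closure_refl:
  assumes "p \<in> beta E"
  shows "p \<in> orbit_closure p"
  using assms ultra_act_one[OF assms] unfolding orbit_closure_eq[OF assms]
  by (auto intro!: bexI[of _ "\<one>\<^bsub>G\<^esub>"])

lemma closed_invariant_orbit_closure:
  assumes p: "p \<in> beta E"
  shows "closed_invariant G E \<phi> (orbit_closure p)"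
  unfolding closed_invariant_def
proof (intro conjI ballI)
  show "closedin (beta_topology E) (orbit_closure p)"
    unfolding orbit_closure_eq[OF p] by (rule closedin_betaI) blast+
  fix g r assume g: "g \<in> carrier G" and "r \<in> orbit_closure p"
  then have r: "r \<in> beta E" "\<forall>B\<in>r. \<exists>g\<in>carrier G. B \<in> ultra_act \<phi> g p"
    unfolding orbit_closure_eq[OF p] by auto
  have "\<exists>k\<in>carrier G. B \<in> ultra_act \<phi> k p" if B: "B \<in> ultra_act \<phi> g r" for B
  proof -
    obtain P where P: "P \<in> r" "B = \<phi> g ` P" using B by (auto simp: ultra_act_def)
    then obtain h where h: "h \<in> carrier G" "P \<in> ultra_act \<phi> h p" using r by blast
    then have "B \<in> ultra_act \<phi> g (ultra_act \<phi> h p)" using P by (auto simp: ultra_act_def)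
    then show ?thesis using ultra_act_mult[OF p g h(1)] m_closed[OF g h(1)] by auto
  qed
  then show "ultra_act \<phi> g r \<in> orbit_closure p"
    unfolding orbit_closure_eq[OF p] using ultra_act_beta[OF g r(1)] by blast
qed

text \<open>If \<open>r\<close> omitted some \<open>B\<close> whose basic set contains
  \<open>T\<close>, then \<open>E - B\<close> would lie in some translate of \<open>p\<close>. That
  translate belongs to \<open>T\<close>, so it contains \<open>B\<close> as well.\<close>

lemma orbit_closure_least:
  assumes T: "closed_invariant G E \<phi> T" and p: "p \<in> T"
  shows "orbit_closure p \<subseteq> T"
proof
  have cl: "closedin (beta_topology E) T" using T by (simp add: closed_invariant_def)
  then have pb: "p \<in> beta E" using p closedin_subset[OF cl] by (auto simp: topspace_beta_topology)
  fix r assume "r \<in> orbit_closure p"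
  then have r: "r \<in> beta E" "\<forall>B\<in>r. \<exists>g\<in>carrier G. B \<in> ultra_act \<phi> g p"
    unfolding orbit_closure_eq[OF pb] by auto
  have "B \<in> r" if B: "B \<subseteq> E" "T \<subseteq> beta_basic E B" for B
  proof (rule ccontr)
    assume "B \<notin> r"
    then have "E - B \<in> r" using beta_Diff_iff r B by blast
    then obtain g where g: "g \<in> carrier G" "E - B \<in> ultra_act \<phi> g p" using r by blast
    moreover have "ultra_act \<phi> g p \<in> T" using T p g by (simp add: closed_invariant_def)
    ultimately show False using B beta_Diff_iff unfolding beta_basic_def by blast
  qed
  then show "r \<in> T" using beta_closure_iff[OF cl r(1)] by blast
qed

section \<open>Minimal closed invariant sets\<close>

text \<open>Zorn's lemma for reverse inclusion: a nonempty chain is bounded by its intersection,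
  which is nonempty by compactness, and the empty chain by \<open>S\<close>.\<close>

lemma minimal_invariant_exists:
  assumes S: "closed_invariant G E \<phi> S" "S \<noteq> {}"
  obtains M where "minimal_invariant G E \<phi> M" "M \<subseteq> S"
proof -
  define \<F> where "\<F> = {T. T \<noteq> {} \<and> closed_invariant G E \<phi> T \<and> T \<subseteq> S}"
  have "\<exists>M\<in>\<F>. \<forall>T\<in>\<F>. (\<supseteq>) M T \<longrightarrow> T = M"
  proof (rule predicate_Zorn)
    show "partial_order_on \<F> (relation_of (\<supseteq>) \<F>)"
      by (rule partial_order_on_relation_ofI) auto
    fix \<C> assume ch: "\<C> \<in> Chains (relation_of (\<supseteq>) \<F>)"
    have ch: "T \<in> \<F> \<and> (T \<subseteq> U \<or> U \<subseteq> T)" if "T \<in> \<C>" "U \<in> \<C>" for T U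
      using ch that unfolding Chains_def relation_of_def by blast
    then have \<C>: "T \<noteq> {}" "closedin (beta_topology E) T" "closed_invariant G E \<phi> T" "T \<subseteq> S"
      if "T \<in> \<C>" for T
      using that unfolding \<F>_def closed_invariant_def by blast+
    show "\<exists>U\<in>\<F>. \<forall>T\<in>\<C>. U \<subseteq> T"
    proof (cases "\<C> = {}")
      case True
      then show ?thesis using S unfolding \<F>_def by blast
    next
      case False
      have "\<Inter>\<C> \<noteq> {}"
        using beta_chain_Inter_nonempty[OF False] \<C>(1,2) ch by blast
      moreover have "closedin (beta_topology E) (\<Inter>\<C>)"
        using False \<C>(2) by (rule closedin_Inter)
      then have "closed_invariant G E \<phi> (\<Inter>\<C>)"
        using \<C>(3) by (simp add: closed_invariant_def)
      moreover have "\<Inter>\<C> \<subseteq> S" using False \<C>(4) by blast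
      ultimately have "\<Inter>\<C> \<in> \<F>" unfolding \<F>_def by blast
      then show ?thesis by blast
    qed
  qed
  then obtain M where M: "M \<in> \<F>" "\<And>T. T \<in> \<F> \<Longrightarrow> T \<subseteq> M \<Longrightarrow> T = M" by blast
  then have "minimal_invariant G E \<phi> M" unfolding minimal_invariant_def \<F>_def by blast
  with M show ?thesis using that unfolding \<F>_def by blast
qed

text \<open>The orbit closure of \<open>p\<close> is a nonempty closed invariant subset of
  \<open>M\<close>. Hence all points of \<open>M\<close> have the same orbit closure, and each lies
  in that of every other.\<close>

lemma minimal_invariant_orbit_closure:
  assumes "minimal_invariant G E \<phi> M" "p \<in> M"
  shows "orbit_closure p = M"
proof -
  have M: "closed_invariant G E \<phi> M" using assms by (simp add: minimal_invariant_def)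
  then have "M \<subseteq> beta E"
    using closedin_subset[of "beta_topology E" M]
    by (simp add: closed_invariant_def topspace_beta_topology)
  then have "p \<in> beta E" using assms(2) by blast
  then have "closed_invariant G E \<phi> (orbit_closure p)" "orbit_closure p \<noteq> {}"
    using closed_invariant_orbit_closure orbit_closure_refl by blast+
  then show ?thesis
    using assms(1) orbit_closure_least[OF M assms(2)] unfolding minimal_invariant_def by blast
qed

text \<open>Group elements act as bijections, so the preimage of a singleton is a singleton.\<close>

lemma closed_invariant_free_ultrafilters:
  "closed_invariant G E \<phi> (free_ultrafilters E)"
  unfolding closed_invariant_def
proof (intro conjI ballI closedin_free_ultrafilters)
  fix g p assume g: "g \<in> carrier G" and "p \<in> free_ultrafilters E"
  then have p: "p \<in> beta E" "\<forall>x\<in>E. {x} \<notin> p" by (auto simp: free_ultrafilters_iff)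
  have "{y} \<notin> ultra_act \<phi> g p" if y: "y \<in> E" for y
  proof
    assume "{y} \<in> ultra_act \<phi> g p"
    then have *: "{x \<in> E. \<phi> g x \<in> {y}} \<in> p" using ultra_act_iff[OF g p(1), of "{y}"] y by simp
    obtain x where x: "x \<in> E" "y = \<phi> g x" using surj_prop[OF g] y by blast
    then have "{x \<in> E. \<phi> g x \<in> {y}} = {x}" using inj_prop[OF g] by (auto simp: inj_on_def)
    with * x p(2) show False by simp
  qed
  then show "ultra_act \<phi> g p \<in> free_ultrafilters E"
    using ultra_act_beta[OF g p(1)] by (simp add: free_ultrafilters_iff)
qed

section \<open>Prethick sets and minimal orbit closures\<close>

lemma prethick_if_minimal:
  assumes p: "p \<in> beta E" and A: "A \<in> p" and min: "minimal_invariant G E \<phi> (orbit_closure p)"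
  shows "prethick G E \<phi> A"
proof -
  have AE: "A \<subseteq> E" using beta_subset[OF p A] .
  \<comment> \<open>By minimality \<open>p\<close> lies in the orbit closure of \<open>r\<close>, so
    the neighbourhood of \<open>p\<close> given by \<open>A\<close> contains a translate of
    \<open>r\<close>.\<close>
  have translate: "\<exists>g\<in>carrier G. \<phi> g ` A \<in> r" if r: "r \<in> orbit_closure p" for r
  proof -
    have rb: "r \<in> beta E" using r orbit_closure_eq[OF p] by blast
    have "p \<in> orbit_closure r"
      using minimal_invariant_orbit_closure[OF min r] orbit_closure_refl[OF p] by simp
    then obtain g where g: "g \<in> carrier G" "A \<in> ultra_act \<phi> g r"
      using A orbit_closure_eq[OF rb] by blast
    then have "\<phi> (inv\<^bsub>G\<^esub> g) ` A \<in> r" using ultra_act_preimage[of "inv\<^bsub>G\<^esub> g" r A] rb AE by simp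
    then show ?thesis using inv_closed[OF g(1)] by blast
  qed
  \<comment> \<open>A compactness argument on the group side. If every \<open>F\<close> failed, the
    nonempty sets \<open>?N F\<close> of bad elements, which shrink as \<open>F\<close> grows, would
    lie in one ultrafilter \<open>q\<close>. By \<open>translate\<close>,
    \<open>ultra_prod G E \<phi> q p\<close> contains some translate of \<open>A\<close> by
    \<open>g\<close>, which is incompatible with \<open>?N {g}\<close> in \<open>q\<close>.\<close>
  have "\<exists>F. finite F \<and> F \<subseteq> carrier G \<and> (\<forall>h\<in>carrier G. set_act \<phi> F A \<in> ultra_act \<phi> h p)"
  proof (rule ccontr)
    assume no: "\<not> ?thesis"
    let ?N = "\<lambda>F. {h \<in> carrier G. set_act \<phi> F A \<notin> ultra_act \<phi> h p}"
    let ?B = "?N ` {F. finite F \<and> F \<subseteq> carrier G}"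
    obtain q where q: "q \<in> beta (carrier G)" "?B \<subseteq> q"
    proof (rule ultrafilter_extension[of ?B "carrier G"])
      show "{} \<notin> ?B" using no by auto
      fix U V assume "U \<in> ?B" "V \<in> ?B"
      then obtain F H where FH: "finite F" "F \<subseteq> carrier G" "U = ?N F"
        "finite H" "H \<subseteq> carrier G" "V = ?N H" by blast
      have "set_act \<phi> F A \<subseteq> set_act \<phi> (F \<union> H) A" "set_act \<phi> H A \<subseteq> set_act \<phi> (F \<union> H) A"
        by (auto simp: set_act_def)
      moreover have "set_act \<phi> (F \<union> H) A \<subseteq> E" using set_act_subset FH AE by simp
      ultimately have "?N (F \<union> H) \<subseteq> U \<inter> V"
        using FH beta_mono[OF ultra_act_beta[OF _ p]] by blast
      moreover have "?N (F \<union> H) \<in> ?B" using FH by blast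
      ultimately show "\<exists>C\<in>?B. C \<subseteq> U \<inter> V" by blast
    qed auto
    have qp: "ultra_prod G E \<phi> q p \<in> orbit_closure p" using q(1) by (auto simp: orbit_closure_def)
    then obtain g where g: "g \<in> carrier G" "\<phi> g ` A \<in> ultra_prod G E \<phi> q p" using translate by blast
    let ?Y = "{h \<in> carrier G. \<phi> g ` A \<in> ultra_act \<phi> h p}"
    have "?Y \<in> q" using g(2) by (simp add: ultra_prod_def)
    moreover have "?N {g} \<in> q" using q(2) g(1) by blast
    ultimately have "?Y \<inter> ?N {g} \<in> q" by (rule beta_Int[OF q(1)])
    moreover have "set_act \<phi> {g} A = \<phi> g ` A" by (auto simp: set_act_def)
    then have "?Y \<inter> ?N {g} = {}" by auto
    ultimately show False using beta_empty[OF q(1)] by simp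
  qed
  then obtain F where F: "finite F" "F \<subseteq> carrier G"
    "\<And>h. h \<in> carrier G \<Longrightarrow> set_act \<phi> F A \<in> ultra_act \<phi> h p" by blast
  let ?T = "set_act \<phi> F A"
  have TE: "?T \<subseteq> E" using set_act_subset F AE by blast
  have "\<exists>b\<in>?T. set_act \<phi> K {b} \<subseteq> ?T" if K: "finite K" "K \<subseteq> carrier G" for K
  proof -
    have "{x \<in> E. \<forall>k\<in>K. x \<in> {x \<in> E. \<phi> k x \<in> ?T}} \<in> p"
      using K F(3) ultra_act_iff[OF _ p TE] by (intro beta_finite_Inter[OF p]) auto
    \<comment> \<open>Thickness asks for \<open>b\<close> in \<open>?T\<close> itself, so the unit
      is used besides the elements of \<open>K\<close>.\<close>
    moreover have "?T \<in> p" using F(3)[OF one_closed] ultra_act_one[OF p] by simp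
    ultimately have "{x \<in> E. \<forall>k\<in>K. x \<in> {x \<in> E. \<phi> k x \<in> ?T}} \<inter> ?T \<in> p"
      by (rule beta_Int[OF p])
    then have "{x \<in> E. \<forall>k\<in>K. x \<in> {x \<in> E. \<phi> k x \<in> ?T}} \<inter> ?T \<noteq> {}"
      using beta_empty[OF p] by metis
    then obtain b where "b \<in> ?T" "\<forall>k\<in>K. \<phi> k b \<in> ?T" by blast
    then show ?thesis unfolding set_act_def[of _ K] by blast
  qed
  then have "thick G E \<phi> ?T" using TE by (simp add: thick_def)
  then show ?thesis using F by (auto simp: prethick_def)
qed

lemma minimal_if_prethick:
  assumes AE: "A \<subseteq> E" and pre: "prethick G E \<phi> A"
  obtains p where "p \<in> beta E" "A \<in> p" "minimal_invariant G E \<phi> (orbit_closure p)"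
proof -
  obtain F where F: "finite F" "F \<subseteq> carrier G" and th: "thick G E \<phi> (set_act \<phi> F A)"
    using pre by (auto simp: prethick_def)
  let ?T = "set_act \<phi> F A"
  have TE: "?T \<subseteq> E" using set_act_subset F AE by blast
  \<comment> \<open>Points sent into \<open>?T\<close> by all of \<open>K\<close>. Thickness makes
    each such set nonempty, and a union of index sets gives the intersection, so some ultrafilter
    \<open>r\<close> contains them all.\<close>
  let ?N = "\<lambda>K. {x \<in> E. \<forall>k\<in>K. \<phi> k x \<in> ?T}"
  let ?B = "?N ` {K. finite K \<and> K \<subseteq> carrier G}"
  obtain r where r: "r \<in> beta E" "?B \<subseteq> r"
  proof (rule ultrafilter_extension[of ?B E])
    have "?N K \<noteq> {}" if K: "finite K" "K \<subseteq> carrier G" for K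
    proof -
      obtain b where "b \<in> ?T" "set_act \<phi> K {b} \<subseteq> ?T" using th K by (auto simp: thick_def)
      moreover from this have "b \<in> E" using TE by blast
      ultimately have "b \<in> ?N K" unfolding set_act_def[of _ K] by blast
      then show ?thesis by blast
    qed
    then show "{} \<notin> ?B" by (metis (no_types, lifting) imageE mem_Collect_eq)
    fix U V assume "U \<in> ?B" "V \<in> ?B"
    then obtain K L where KL: "finite K" "K \<subseteq> carrier G" "U = ?N K"
      "finite L" "L \<subseteq> carrier G" "V = ?N L" by blast
    then have "?N (K \<union> L) \<in> ?B" "?N (K \<union> L) \<subseteq> U \<inter> V" by auto
    then show "\<exists>C\<in>?B. C \<subseteq> U \<inter> V" by blast
  qed auto
  have Tr: "?T \<in> ultra_act \<phi> g r" if g: "g \<in> carrier G" for g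
  proof -
    have "?N {g} \<in> r" using r(2) g by blast
    then show ?thesis using ultra_act_iff[OF g r(1) TE] by simp
  qed
  obtain M where M: "minimal_invariant G E \<phi> M" "M \<subseteq> orbit_closure r"
    using minimal_invariant_exists[OF closed_invariant_orbit_closure[OF r(1)]]
      orbit_closure_refl[OF r(1)] by blast
  then obtain s where s: "s \<in> M" by (auto simp: minimal_invariant_def)
  then have sr: "s \<in> beta E" "\<forall>B\<in>s. \<exists>g\<in>carrier G. B \<in> ultra_act \<phi> g r"
    using M(2) orbit_closure_eq[OF r(1)] by auto
  \<comment> \<open>Each member of \<open>s\<close> lies in some translate of \<open>r\<close>,
    while \<open>?T\<close> lies in all of them; the complement of \<open>?T\<close> thus cannot
    belong to \<open>s\<close>.\<close>
  have "?T \<in> s"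
  proof (rule ccontr)
    assume "?T \<notin> s"
    then have "E - ?T \<in> s" using beta_Diff_iff[OF sr(1) TE] by simp
    then obtain g where g: "g \<in> carrier G" "E - ?T \<in> ultra_act \<phi> g r" using sr(2) by blast
    then show False using beta_Diff_iff[OF ultra_act_beta[OF g(1) r(1)] TE] Tr by simp
  qed
  moreover have "?T = (\<Union>f\<in>F. \<phi> f ` A)" by (auto simp: set_act_def)
  ultimately have "\<exists>f\<in>F. \<phi> f ` A \<in> s"
    using TE by (intro beta_UN[OF sr(1) F(1)]) auto
  then obtain f where f: "f \<in> F" "\<phi> f ` A \<in> s" by blast
  \<comment> \<open>Moving \<open>s\<close> by the inverse of \<open>f\<close> turns the translate
    of \<open>A\<close> into \<open>A\<close> and stays inside the invariant set
    \<open>M\<close>.\<close>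
  let ?p = "ultra_act \<phi> (inv\<^bsub>G\<^esub> f) s"
  have fG: "f \<in> carrier G" using f F by blast
  then have iG: "inv\<^bsub>G\<^esub> f \<in> carrier G" by simp
  have "?p \<in> M" using M(1) s iG by (auto simp: minimal_invariant_def closed_invariant_def)
  then have "minimal_invariant G E \<phi> (orbit_closure ?p)"
    using minimal_invariant_orbit_closure[OF M(1)] M(1) by simp
  moreover have "A \<in> ?p" using ultra_act_preimage[OF fG sr(1) AE] f(2) by simp
  ultimately show ?thesis using that ultra_act_beta[OF iG sr(1)] by blast
qed

end

text \<open>If \<open>{x}\<close> were in \<open>p\<close>, transitivity would move \<open>x\<close>
  into any nonempty set, so the orbit closure of \<open>p\<close> would contain every free
  ultrafilter. Since the free ultrafilters form a nonempty closed invariant set, minimality would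
  make the two sets equal, although \<open>p\<close> lies only in the first.\<close>

lemma (in transitive_action) minimal_orbit_closure_free:
  assumes "infinite E" and p: "p \<in> beta E" and min: "minimal_invariant G E \<phi> (orbit_closure p)"
  shows "p \<in> free_ultrafilters E"
proof (rule ccontr)
  assume "p \<notin> free_ultrafilters E"
  then obtain x where x: "x \<in> E" "{x} \<in> p" using p by (auto simp: free_ultrafilters_iff)
  have "free_ultrafilters E \<subseteq> orbit_closure p"
  proof
    fix r assume "r \<in> free_ultrafilters E"
    then have r: "r \<in> beta E" by (simp add: free_ultrafilters_iff)
    have "\<exists>g\<in>carrier G. B \<in> ultra_act \<phi> g p" if B: "B \<in> r" for B
    proof -
      have BE: "B \<subseteq> E" using beta_subset[OF r B] .
      obtain y where y: "y \<in> B" using B beta_empty[OF r] by (cases "B = {}") auto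
      then obtain g where g: "g \<in> carrier G" "\<phi> g x = y" using unique_orbit x BE by blast
      have "{x \<in> E. \<phi> g x \<in> B} \<in> p"
        by (rule beta_mono[OF p x(2)]) (use g y x in auto)
      then show ?thesis using ultra_act_iff[OF g(1) p BE] g(1) by blast
    qed
    then show "r \<in> orbit_closure p" unfolding orbit_closure_eq[OF p] using r by blast
  qed
  then have "free_ultrafilters E = orbit_closure p"
    using min closed_invariant_free_ultrafilters free_ultrafilters_nonempty[OF assms(1)]
    unfolding minimal_invariant_def by blast
  then show False using orbit_closure_refl[OF p] \<open>p \<notin> free_ultrafilters E\<close> by simp
qed

theorem theorem4p2:
  fixes G :: "('g, 'm) monoid_scheme"
    and X :: "'x set"
    and \<phi> :: "'g \<Rightarrow> 'x \<Rightarrow> 'x"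
    and A :: "'x set"
  assumes "transitive_action G X \<phi>"
    and "infinite X"
    and "A \<subseteq> X"
  shows "prethick G X \<phi> A \<longleftrightarrow>
    (\<exists>p\<in>free_ultrafilters X. A \<in> p \<and>
       minimal_invariant G X \<phi> {ultra_prod G X \<phi> q p | q. q \<in> beta (carrier G)})"
proof -
  interpret transitive_action G X \<phi> by (rule assms(1))
  show ?thesis
    unfolding orbit_closure_def[symmetric]
    using minimal_if_prethick[OF assms(3)] minimal_orbit_closure_free[OF assms(2)]
      prethick_if_minimal free_ultrafilters_iff
    by metis
qed

end
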